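(* Let $d\ge1$. The 2-group $\mathrm{PGL}(d,d)$ is given by the crossed-module $$[\alpha:\mathbb{C}^*\to GL_2(\mathbb{C})],\qquad \alpha(\lambda)=\mathrm{diag}(\lambda^d,\lambda^d),$$ and $\pi_1\mathrm{PGL}(d,d)\cong PGL_2(\mathbb{C})$ and $\pi_2\mathrm{PGL}(d,d)\cong\mathbb{Z}_d$.
   Context: A crossed-module $[\varphi:G_2\to G_1]$ is a group homomorphism with a right action of $G_1$ on $G_2$ that lifts the conjugation action of $G_1$ on the image of $\varphi$ and restricts along $\varphi$ to the conjugation action of $G_2$ on itself. Crossed-modules are equivalent to (strict) 2-groups, and the two terms are used synonymously. For $\mathfrak{G}=[\varphi:G_2\to G_1]$ one has $\pi_1\mathfrak{G}=\mathrm{coker}\,\varphi$ and $\pi_2\mathfrak{G}=\ker\varphi$. $\mathrm{PGL}(m,n)$ is the 2-group associated to the crossed-module $[\varphi:\mathbb{C}^*\to G_{m,n}]$, where $G_{m,n}$ is the group of algebraic automorphisms of $\mathbb{C}^2\setminus\{0\}$ that are equivariant for the $\mathbb{C}^*$-action $t\cdot(x,y)=(t^mx,t^ny)$, $\varphi(\lambda)$ is the action of $\lambda$, and $G_{m,n}$ acts trivially on $\mathbb{C}^*$. In the crossed-module $[\alpha:\mathbb{C}^*\to GL_2(\mathbb{C})]$ the action of $GL_2(\mathbb{C})$ on $\mathbb{C}^*$ is trivial. *)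

theory Defs
  imports
    "HOL-Analysis.Analysis"
    "HOL-Computational_Algebra.Polynomial"
    "HOL-Algebra.Bij"
    "HOL-Algebra.Elementary_Groups"
begin

section \<open>Crossed modules\<close>

text \<open>
  \<open>[bd : src \<rightarrow> tgt]\<close> is the structure homomorphism \<open>\<phi> : G\<^sub>2 \<rightarrow> G\<^sub>1\<close>, and \<open>act X x g\<close>
  is the right action \<open>x\<^sup>g\<close> of \<open>g \<in> G\<^sub>1\<close> on \<open>x \<in> G\<^sub>2\<close>.
\<close>

record ('a, 'b) crossed_module_data =
  src :: "'a monoid"
  tgt :: "'b monoid"
  bd :: "'a \<Rightarrow> 'b"
  act :: "'a \<Rightarrow> 'b \<Rightarrow> 'a"

definition crossed_module :: "('a, 'b) crossed_module_data \<Rightarrow> bool" where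
  "crossed_module X \<longleftrightarrow>
     group (src X) \<and> group (tgt X) \<and> bd X \<in> hom (src X) (tgt X) \<and>
     (\<forall>x\<in>carrier (src X). \<forall>g\<in>carrier (tgt X). act X x g \<in> carrier (src X)) \<and>
     (\<forall>x\<in>carrier (src X). act X x \<one>\<^bsub>tgt X\<^esub> = x) \<and>
     (\<forall>x\<in>carrier (src X). \<forall>g\<in>carrier (tgt X). \<forall>h\<in>carrier (tgt X).
        act X x (g \<otimes>\<^bsub>tgt X\<^esub> h) = act X (act X x g) h) \<and>
     (\<forall>x\<in>carrier (src X). \<forall>y\<in>carrier (src X). \<forall>g\<in>carrier (tgt X).
        act X (x \<otimes>\<^bsub>src X\<^esub> y) g = act X x g \<otimes>\<^bsub>src X\<^esub> act X y g) \<and>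
     (\<forall>x\<in>carrier (src X). \<forall>g\<in>carrier (tgt X).
        bd X (act X x g) = inv\<^bsub>tgt X\<^esub> g \<otimes>\<^bsub>tgt X\<^esub> bd X x \<otimes>\<^bsub>tgt X\<^esub> g) \<and>
     (\<forall>x\<in>carrier (src X). \<forall>y\<in>carrier (src X).
        act X x (bd X y) = inv\<^bsub>src X\<^esub> y \<otimes>\<^bsub>src X\<^esub> x \<otimes>\<^bsub>src X\<^esub> y)"

definition crossed_module_isomorphic ::
    "('a, 'b) crossed_module_data \<Rightarrow> ('c, 'd) crossed_module_data \<Rightarrow> bool" where
  "crossed_module_isomorphic X Y \<longleftrightarrow>
     (\<exists>f2 \<in> iso (src X) (src Y). \<exists>f1 \<in> iso (tgt X) (tgt Y).
        (\<forall>x\<in>carrier (src X). f1 (bd X x) = bd Y (f2 x)) \<and>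
        (\<forall>x\<in>carrier (src X). \<forall>g\<in>carrier (tgt X). f2 (act X x g) = act Y (f2 x) (f1 g)))"

definition pi1 :: "('a, 'b) crossed_module_data \<Rightarrow> 'b set monoid" where
  "pi1 X = tgt X Mod (bd X ` carrier (src X))"

definition pi2 :: "('a, 'b) crossed_module_data \<Rightarrow> 'a monoid" where
  "pi2 X = (src X)\<lparr>carrier := kernel (src X) (tgt X) (bd X)\<rparr>"


section \<open>Algebraic automorphisms of the punctured affine plane\<close>

text \<open>
  A bivariate polynomial is a polynomial in the second coordinate whose coefficients are
  polynomials in the first one.
\<close>

definition eval2 :: "complex poly poly \<Rightarrow> complex^2 \<Rightarrow> complex" where
  "eval2 p v = poly (poly p [:v $ 2:]) (v $ 1)"

definition zariski_open :: "(complex^2) set \<Rightarrow> bool" where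
  "zariski_open U \<longleftrightarrow> (\<exists>P. U = - {v. \<forall>p\<in>P. eval2 p v = 0})"

definition regular_function_on :: "(complex^2) set \<Rightarrow> (complex^2 \<Rightarrow> complex) \<Rightarrow> bool" where
  "regular_function_on Y f \<longleftrightarrow>
     (\<forall>v\<in>Y. \<exists>U g h. zariski_open U \<and> v \<in> U \<and>
        (\<forall>w\<in>U \<inter> Y. eval2 h w \<noteq> 0 \<and> f w = eval2 g w / eval2 h w))"

text \<open>A map into a subset of affine space is a morphism if its coordinates are regular.\<close>

definition regular_map_on :: "(complex^2) set \<Rightarrow> (complex^2 \<Rightarrow> complex^2) \<Rightarrow> bool" where
  "regular_map_on Y f \<longleftrightarrow> (\<forall>i. regular_function_on Y (\<lambda>v. f v $ i))"

definition algebraic_automorphism ::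
    "(complex^2) set \<Rightarrow> (complex^2 \<Rightarrow> complex^2) \<Rightarrow> bool" where
  "algebraic_automorphism Y f \<longleftrightarrow>
     f \<in> Bij Y \<and> regular_map_on Y f \<and> regular_map_on Y (inv_into Y f)"

definition punctured_plane :: "(complex^2) set" where
  "punctured_plane = - {0}"


section \<open>The 2-groups $\mathrm{PGL}(m,n)$\<close>

definition Cstar :: "complex monoid" where
  "Cstar = \<lparr>carrier = - {0}, monoid.mult = (*), one = 1\<rparr>"

definition weighted_action :: "nat \<Rightarrow> nat \<Rightarrow> complex \<Rightarrow> complex^2 \<Rightarrow> complex^2" where
  "weighted_action m n t v = vector [t ^ m * v $ 1, t ^ n * v $ 2]"

definition G_weighted :: "nat \<Rightarrow> nat \<Rightarrow> (complex^2 \<Rightarrow> complex^2) monoid" where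
  "G_weighted m n = (BijGroup punctured_plane)
     \<lparr>carrier := {f. algebraic_automorphism punctured_plane f \<and>
        (\<forall>t\<in>carrier Cstar. \<forall>v\<in>punctured_plane.
           f (weighted_action m n t v) = weighted_action m n t (f v))}\<rparr>"

definition PGL_weighted ::
    "nat \<Rightarrow> nat \<Rightarrow> (complex, complex^2 \<Rightarrow> complex^2) crossed_module_data" where
  "PGL_weighted m n =
     \<lparr>src = Cstar, tgt = G_weighted m n,
      bd = (\<lambda>t. restrict (weighted_action m n t) punctured_plane),
      act = (\<lambda>t f. t)\<rparr>"


section \<open>The linear groups\<close>

definition GL2 :: "(complex^2^2) monoid" where
  "GL2 = \<lparr>carrier = {A. invertible A}, monoid.mult = (**), one = mat 1\<rparr>"

definition PGL2 :: "(complex^2^2) set monoid" where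
  "PGL2 = GL2 Mod {mat c |c. c \<noteq> 0}"

definition GL2_crossed_module :: "nat \<Rightarrow> (complex, complex^2^2) crossed_module_data" where
  "GL2_crossed_module d =
     \<lparr>src = Cstar, tgt = GL2, bd = (\<lambda>t. mat (t ^ d)), act = (\<lambda>t A. t)\<rparr>"

end

theory Submission
  imports Defs "HOL-Complex_Analysis.Cauchy_Integral_Formula"
begin

text \<open>
  Everything follows from one fact: an algebraic automorphism \<open>f\<close> of the punctured plane that
  commutes with the weight-\<open>(d, d)\<close> action is linear. Every nonzero complex number is a \<open>d\<close>-th
  power, so such an \<open>f\<close> commutes with all nonzero scalars, and each of its coordinates is a
  regular function \<open>F\<close> that is homogeneous of degree one.

  That such an \<open>F\<close> is a linear form (\<open>regular_homogeneous_linear\<close>) is seen on the two affine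
  charts of the projective line. The functions \<open>\<phi>(z) = F(1, z)\<close> and \<open>\<psi>(w) = F(w, 1)\<close> are locally
  quotients of polynomials with nonvanishing denominators, hence entire, and homogeneity glues
  them by \<open>\<phi>(z) = z \<psi>(1/z)\<close>. As \<open>\<psi>\<close> is bounded near \<open>0\<close>, \<open>\<phi>\<close> grows at most linearly, so
  Liouville's theorem makes it affine: the only sections of the line bundle \<open>\<O>(1)\<close> are the
  linear forms.

  Conversely every invertible matrix acts on the punctured plane by an equivariant algebraic
  automorphism, so restricting linear maps identifies \<open>GL\<^sub>2\<close> with the target group of
  \<open>PGL(d, d)\<close> (\<open>G_weighted_diagonal\<close>). Under this identification \<open>t\<close> acts as the scalar matrix
  \<open>t\<^sup>d\<close>, which gives the isomorphism of crossed modules. The groups \<open>\<pi>\<^sub>1\<close> and \<open>\<pi>\<^sub>2\<close> are invariant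
  under isomorphism (\<open>pi1_cong\<close>, \<open>pi2_cong\<close>), so they can be read off from
  \<open>[\<complex>\<^sup>* \<rightarrow> GL\<^sub>2]\<close>: the image of the boundary map is the group of all
  nonzero scalar matrices, again because \<open>d\<close>-th roots exist, and its kernel is the group of
  \<open>d\<close>-th roots of unity.
\<close>

section \<open>Crossed modules\<close>

text \<open>
  Equivariance of the boundary map says exactly that a conjugate of \<open>bd X x\<close> is the image of a
  translate of \<open>x\<close>.
\<close>

lemma boundary_image_normal:
  assumes "crossed_module X"
  shows "bd X ` carrier (src X) \<lhd> tgt X"
proof -
  interpret S: group "src X" using assms by (simp add: crossed_module_def)
  interpret T: group "tgt X" using assms by (simp add: crossed_module_def)
  interpret h: group_hom "src X" "tgt X" "bd X"
    using assms by (unfold_locales) (simp add: crossed_module_def)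
  have "g \<otimes>\<^bsub>tgt X\<^esub> bd X x \<otimes>\<^bsub>tgt X\<^esub> inv\<^bsub>tgt X\<^esub> g \<in> bd X ` carrier (src X)"
    if "g \<in> carrier (tgt X)" "x \<in> carrier (src X)" for g x
  proof -
    have "inv\<^bsub>tgt X\<^esub> g \<in> carrier (tgt X)"
      using that by simp
    then have "act X x (inv\<^bsub>tgt X\<^esub> g) \<in> carrier (src X)"
      and "bd X (act X x (inv\<^bsub>tgt X\<^esub> g)) = g \<otimes>\<^bsub>tgt X\<^esub> bd X x \<otimes>\<^bsub>tgt X\<^esub> inv\<^bsub>tgt X\<^esub> g"
      using assms that by (simp_all add: crossed_module_def)
    then show ?thesis by (metis image_eqI)
  qed
  then show ?thesis
    using h.img_is_subgroup by (auto simp: T.normal_inv_iff)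
qed

text \<open>
  The first isomorphism theorem, applied to the composite of the isomorphism of targets with
  the projection of \<open>tgt Y\<close> onto \<open>pi1 Y\<close>: its kernel is the preimage of the boundary image of
  \<open>Y\<close>, which is the boundary image of \<open>X\<close>.
\<close>

lemma pi1_cong:
  assumes X: "crossed_module X" and Y: "crossed_module Y" and XY: "crossed_module_isomorphic X Y"
  shows "pi1 X \<cong> pi1 Y"
proof -
  obtain f2 f1 where f2: "f2 \<in> iso (src X) (src Y)" and f1: "f1 \<in> iso (tgt X) (tgt Y)"
    and bd: "\<And>x. x \<in> carrier (src X) \<Longrightarrow> f1 (bd X x) = bd Y (f2 x)"
    using XY unfolding crossed_module_isomorphic_def by blast
  define N where "N = bd Y ` carrier (src Y)"
  interpret N: normal N "tgt Y"
    unfolding N_def by (rule boundary_image_normal[OF Y])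
  have im: "f1 ` (bd X ` carrier (src X)) = N"
  proof -
    have "f1 ` (bd X ` carrier (src X)) = bd Y ` (f2 ` carrier (src X))"
      using bd by (simp add: image_image)
    then show ?thesis
      using f2 by (simp add: N_def iso_def bij_betw_def)
  qed
  have bdX: "bd X ` carrier (src X) \<subseteq> carrier (tgt X)"
    using X by (auto simp: crossed_module_def hom_def)
  have f1h: "f1 \<in> hom (tgt X) (tgt Y)" and f1inj: "inj_on f1 (carrier (tgt X))"
    and f1im: "f1 ` carrier (tgt X) = carrier (tgt Y)"
    using f1 by (auto simp: iso_def bij_betw_def)
  define h where "h = (\<lambda>a. N #>\<^bsub>tgt Y\<^esub> a) \<circ> f1"
  have "h \<in> hom (tgt X) (tgt Y Mod N)"
    unfolding h_def by (rule hom_compose[OF f1h N.r_coset_hom_Mod])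
  then interpret h: group_hom "tgt X" "tgt Y Mod N" h
    using X N.factorgroup_is_group
    by (simp add: group_hom_def group_hom_axioms_def crossed_module_def)
  have "h ` carrier (tgt X) = carrier (tgt Y Mod N)"
    unfolding h_def image_comp[symmetric] f1im by (auto simp: FactGroup_def RCOSETS_def)
  moreover have "kernel (tgt X) (tgt Y Mod N) h = bd X ` carrier (src X)"
  proof -
    have "h a = N \<longleftrightarrow> f1 a \<in> N" if "a \<in> carrier (tgt X)" for a
      using that f1im N.coset_join1 N.coset_join2 N.subgroup_axioms unfolding h_def
      by (metis comp_apply imageI)
    moreover have "f1 a \<in> N \<longleftrightarrow> a \<in> bd X ` carrier (src X)" if "a \<in> carrier (tgt X)" for a
      using inj_on_image_mem_iff[OF f1inj that bdX] unfolding im .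
    ultimately show ?thesis
      using bdX by (auto simp: kernel_def FactGroup_def)
  qed
  ultimately show ?thesis
    using h.FactGroup_iso unfolding pi1_def N_def by simp
qed

lemma pi2_cong:
  assumes X: "crossed_module X" and Y: "crossed_module Y" and XY: "crossed_module_isomorphic X Y"
  shows "pi2 X \<cong> pi2 Y"
proof -
  obtain f2 f1 where f2: "f2 \<in> iso (src X) (src Y)" and f1: "f1 \<in> iso (tgt X) (tgt Y)"
    and bd: "\<And>x. x \<in> carrier (src X) \<Longrightarrow> f1 (bd X x) = bd Y (f2 x)"
    using XY unfolding crossed_module_isomorphic_def by blast
  interpret f1: group_hom "tgt X" "tgt Y" f1
    using X Y f1 by (simp add: group_hom_def group_hom_axioms_def crossed_module_def iso_def)
  have one: "f1 b = \<one>\<^bsub>tgt Y\<^esub> \<longleftrightarrow> b = \<one>\<^bsub>tgt X\<^esub>" if "b \<in> carrier (tgt X)" for b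
    using f1 f1.iso_iff that f1.hom_one by blast
  have bdX: "bd X x \<in> carrier (tgt X)" if "x \<in> carrier (src X)" for x
    using X that by (auto simp: crossed_module_def hom_def)
  have f2im: "f2 ` carrier (src X) = carrier (src Y)" and f2inj: "inj_on f2 (carrier (src X))"
    and f2h: "f2 \<in> hom (src X) (src Y)"
    using f2 by (auto simp: iso_def bij_betw_def)
  have ker: "f2 x \<in> kernel (src Y) (tgt Y) (bd Y) \<longleftrightarrow> x \<in> kernel (src X) (tgt X) (bd X)"
    if "x \<in> carrier (src X)" for x
    using that f2im bd[OF that] one[OF bdX[OF that]] by (auto simp: kernel_def)
  have "f2 ` kernel (src X) (tgt X) (bd X) = kernel (src Y) (tgt Y) (bd Y)"
  proof
    show "f2 ` kernel (src X) (tgt X) (bd X) \<subseteq> kernel (src Y) (tgt Y) (bd Y)"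
      using ker by (auto simp: kernel_def)
    show "kernel (src Y) (tgt Y) (bd Y) \<subseteq> f2 ` kernel (src X) (tgt X) (bd X)"
    proof
      fix y assume y: "y \<in> kernel (src Y) (tgt Y) (bd Y)"
      then obtain x where "x \<in> carrier (src X)" "y = f2 x"
        using f2im by (auto simp: kernel_def)
      then show "y \<in> f2 ` kernel (src X) (tgt X) (bd X)"
        using y ker by blast
    qed
  qed
  moreover have "inj_on f2 (kernel (src X) (tgt X) (bd X))"
    using f2inj by (rule inj_on_subset) (auto simp: kernel_def)
  ultimately have "f2 \<in> iso (pi2 X) (pi2 Y)"
    using f2h by (auto simp: iso_def bij_betw_def hom_def pi2_def kernel_def)
  then show ?thesis unfolding is_iso_def by blast
qed

text \<open>
  With a trivial action, equivariance of the boundary map and the Peiffer identity turn into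
  centrality of the image and commutativity of the source.
\<close>

lemma crossed_module_central:
  assumes "comm_group (src X)" "group (tgt X)" "bd X \<in> hom (src X) (tgt X)"
    and trivial: "\<And>x g. act X x g = x"
    and central: "\<And>x g. x \<in> carrier (src X) \<Longrightarrow> g \<in> carrier (tgt X) \<Longrightarrow>
      bd X x \<otimes>\<^bsub>tgt X\<^esub> g = g \<otimes>\<^bsub>tgt X\<^esub> bd X x"
  shows "crossed_module X"
proof -
  interpret S: comm_group "src X" by fact
  interpret T: group "tgt X" by fact
  interpret h: group_hom "src X" "tgt X" "bd X"
    using assms(3) by unfold_locales
  have "bd X x = inv\<^bsub>tgt X\<^esub> g \<otimes>\<^bsub>tgt X\<^esub> bd X x \<otimes>\<^bsub>tgt X\<^esub> g"
    if "x \<in> carrier (src X)" "g \<in> carrier (tgt X)" for x g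
    using central[OF that] that by (simp add: T.m_assoc T.inv_solve_left)
  moreover have "x = inv\<^bsub>src X\<^esub> y \<otimes>\<^bsub>src X\<^esub> x \<otimes>\<^bsub>src X\<^esub> y"
    if "x \<in> carrier (src X)" "y \<in> carrier (src X)" for x y
    using that by (simp add: S.m_assoc S.m_comm[of x y] S.inv_solve_left)
  ultimately show ?thesis
    unfolding crossed_module_def trivial
    using assms(3) S.is_group T.is_group by blast
qed

section \<open>Homogeneous regular functions on the punctured plane\<close>

lemma eval2_pCons: "eval2 (pCons c p) v = poly c (v $ 1) + v $ 2 * eval2 p v"
  by (simp add: eval2_def)

lemma eval2_holomorphic:
  assumes "x holomorphic_on UNIV" "y holomorphic_on UNIV"
  shows "(\<lambda>z. eval2 p (vector [x z, y z])) holomorphic_on UNIV"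
proof (induction p)
  case 0
  then show ?case by (simp add: eval2_def)
next
  case (pCons c p)
  have "(\<lambda>z. poly c (x z)) holomorphic_on UNIV"
  proof (induction c)
    case (pCons a c)
    then show ?case using assms by (auto intro!: holomorphic_intros)
  qed simp
  then show ?case
    using pCons.IH assms by (auto simp: eval2_pCons intro!: holomorphic_intros)
qed

text \<open>
  The quotient that represents \<open>F\<close> near a point of an entire curve is valid on a Zariski open
  set. Its preimage under the curve is open in the usual topology, because polynomials are
  continuous along the curve.
\<close>

lemma regular_function_holomorphic:
  assumes F: "regular_function_on Y F"
    and x: "x holomorphic_on UNIV" and y: "y holomorphic_on UNIV"
    and Y: "\<And>z. vector [x z, y z] \<in> Y"
  shows "(\<lambda>z. F (vector [x z, y z])) holomorphic_on UNIV"
proof -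
  define \<gamma> :: "complex \<Rightarrow> complex^2" where "\<gamma> z = vector [x z, y z]" for z
  have hol: "(\<lambda>z. eval2 p (\<gamma> z)) holomorphic_on UNIV" for p
    unfolding \<gamma>_def by (rule eval2_holomorphic[OF x y])
  have "(\<lambda>z. F (\<gamma> z)) field_differentiable at z" for z
  proof -
    have "\<gamma> z \<in> Y" using Y by (simp add: \<gamma>_def)
    with F obtain U g h where U: "zariski_open U" "\<gamma> z \<in> U"
      and quot: "\<And>w. w \<in> U \<inter> Y \<Longrightarrow> eval2 h w \<noteq> 0 \<and> F w = eval2 g w / eval2 h w"
      unfolding regular_function_on_def by metis
    obtain P where P: "U = - {v. \<forall>p\<in>P. eval2 p v = 0}"
      using U(1) unfolding zariski_open_def by blast
    have "\<gamma> -` U = (\<Union>p\<in>P. {w. eval2 p (\<gamma> w) \<noteq> 0})"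
      by (auto simp: P)
    moreover have "open {w. eval2 p (\<gamma> w) \<noteq> 0}" for p
      using holomorphic_on_imp_continuous_on[OF hol[of p]]
      by (intro open_Collect_neq) auto
    ultimately have op: "open (\<gamma> -` U)" by auto
    have "(\<lambda>w. eval2 g (\<gamma> w) / eval2 h (\<gamma> w)) holomorphic_on \<gamma> -` U"
      using quot Y by (intro holomorphic_on_divide holomorphic_on_subset[OF hol])
        (auto simp: \<gamma>_def)
    then have "(\<lambda>w. F (\<gamma> w)) holomorphic_on \<gamma> -` U"
      by (rule holomorphic_transform) (use quot Y in \<open>auto simp: \<gamma>_def\<close>)
    then show ?thesis
      using op U(2) by (simp add: holomorphic_on_imp_differentiable_at)
  qed
  then show ?thesis
    by (simp add: holomorphic_on_def \<gamma>_def)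
qed

text \<open>
  Homogeneity determines \<open>F\<close> on each coordinate chart by an entire function of one variable, and
  Liouville's theorem applies to the first of them because the second one controls it at
  infinity. The coefficient \<open>b\<close> of the linear form on the line \<open>v $ 1 = 0\<close>, which the first chart
  misses, comes from continuity of the second function at \<open>0\<close>.
\<close>

lemma regular_homogeneous_linear:
  assumes F: "regular_function_on punctured_plane F"
    and hom: "\<And>s v. s \<noteq> 0 \<Longrightarrow> v \<in> punctured_plane \<Longrightarrow> F (s *s v) = s * F v"
  shows "\<exists>a b. \<forall>v\<in>punctured_plane. F v = a * v $ 1 + b * v $ 2"
proof -
  define \<phi> where "\<phi> z = F (vector [1, z])" for z
  define \<psi> where "\<psi> w = F (vector [w, 1])" for w
  have mem: "v \<in> punctured_plane \<longleftrightarrow> v $ 1 \<noteq> 0 \<or> v $ 2 \<noteq> 0" for v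
    by (auto simp: punctured_plane_def vec_eq_iff forall_2)
  have \<phi>: "\<phi> holomorphic_on UNIV" and \<psi>: "\<psi> holomorphic_on UNIV"
    unfolding \<phi>_def \<psi>_def
    by (rule regular_function_holomorphic[OF F]; auto simp: mem intro!: holomorphic_intros)+
  have x: "F v = v $ 1 * \<phi> (v $ 2 / v $ 1)" if "v $ 1 \<noteq> 0" for v
  proof -
    have "v = v $ 1 *s vector [1, v $ 2 / v $ 1]"
      using that by (simp add: vec_eq_iff forall_2)
    then show ?thesis
      using hom[OF that, of "vector [1, v $ 2 / v $ 1]"] by (simp add: mem \<phi>_def)
  qed
  have y: "F v = v $ 2 * \<psi> (v $ 1 / v $ 2)" if "v $ 2 \<noteq> 0" for v
  proof -
    have "v = v $ 2 *s vector [v $ 1 / v $ 2, 1]"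
      using that by (simp add: vec_eq_iff forall_2)
    then show ?thesis
      using hom[OF that, of "vector [v $ 1 / v $ 2, 1]"] by (simp add: mem \<psi>_def)
  qed
  \<comment> \<open>The transition between the two charts.\<close>
  have glue: "\<phi> z = z * \<psi> (1 / z)" if "z \<noteq> 0" for z
    using y[of "vector [1, z]"] that by (simp add: \<phi>_def)
  have cont: "continuous_on UNIV \<psi>"
    using \<psi> by (rule holomorphic_on_imp_continuous_on)
  have "compact (\<psi> ` cball 0 1)"
    using cont by (intro compact_continuous_image) (auto intro: continuous_on_subset)
  then obtain B where B: "\<And>w. w \<in> cball 0 1 \<Longrightarrow> norm (\<psi> w) \<le> B"
    using compact_imp_bounded bounded_iff by (metis imageI)
  have growth: "norm (\<phi> z) \<le> B * norm z ^ 1" if "1 \<le> norm z" for z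
  proof -
    have "z \<noteq> 0" using that by auto
    moreover have "norm (\<psi> (1 / z)) \<le> B"
      using that by (intro B) (simp add: norm_divide divide_simps)
    ultimately show ?thesis
      by (simp add: glue norm_mult mult.commute mult_left_mono)
  qed
  define a where "a = \<phi> 0"
  define b where "b = deriv \<phi> 0"
  have affine: "\<phi> z = a + b * z" for z
    using Liouville_polynomial[OF \<phi> growth, where \<xi> = z] by (simp add: a_def b_def)
  have \<psi>_affine: "\<psi> w = a * w + b" if "w \<noteq> 0" for w
    using glue[of "1 / w"] that by (simp add: affine field_simps)
  have "\<psi> 0 = b"
  proof (rule tendsto_unique)
    show "(\<psi> \<longlongrightarrow> \<psi> 0) (at 0)"
      using cont by (simp add: continuous_on_eq_continuous_at isContD)
    have "((\<lambda>w. a * w + b) \<longlongrightarrow> a * 0 + b) (at 0)"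
      by (intro tendsto_intros)
    then show "(\<psi> \<longlongrightarrow> b) (at 0)"
      by (simp, elim Lim_transform_eventually) (simp add: \<psi>_affine eventually_at_filter)
  qed simp
  have "F v = a * v $ 1 + b * v $ 2" if "v \<in> punctured_plane" for v
  proof (cases "v $ 1 = 0")
    case True
    with that y[of v] show ?thesis by (simp add: mem \<open>\<psi> 0 = b\<close>)
  next
    case False
    then have "F v = v $ 1 * (a + b * (v $ 2 / v $ 1))"
      by (simp add: x affine)
    also have "\<dots> = a * v $ 1 + b * v $ 2"
      using False by (simp add: distrib_left)
    finally show ?thesis .
  qed
  then show ?thesis by blast
qed

section \<open>Linear automorphisms of the punctured plane\<close>

text \<open>
  Restriction makes the map extensional, as the elements of \<open>BijGroup\<close> are.
\<close>

definition linear_automorphism :: "complex^2^2 \<Rightarrow> complex^2 \<Rightarrow> complex^2" where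
  "linear_automorphism A = restrict ((*v) A) punctured_plane"

lemma GL2_group: "group GL2"
proof (rule groupI)
  fix A assume "A \<in> carrier GL2"
  then show "\<exists>B\<in>carrier GL2. B \<otimes>\<^bsub>GL2\<^esub> A = \<one>\<^bsub>GL2\<^esub>"
    by (auto simp: GL2_def invertible_def)
qed (auto simp: GL2_def invertible_mult matrix_mul_assoc invertible_def[of "mat 1"] intro!: exI[of _ "mat 1"])

lemma invertible_iff_ker:
  fixes A :: "complex^'n^'n"
  shows "invertible A \<longleftrightarrow> (\<forall>v. A *v v = 0 \<longrightarrow> v = 0)"
  by (simp add: invertible_left_inverse matrix_left_invertible_ker)

lemma matrix_vector_mult_2:
  fixes A :: "complex^2^2"
  shows "(A *v v) $ i = A $ i $ 1 * v $ 1 + A $ i $ 2 * v $ 2"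
  by (simp add: matrix_vector_mult_def sum_2)

lemma mat_vector_mult: "(mat c :: complex^2^2) *v v = c *s v"
  by (simp add: vec_eq_iff forall_2 matrix_vector_mult_2 mat_def)

lemma mat_mult_commute:
  fixes A :: "complex^2^2"
  shows "mat c ** A = A ** mat c"
proof -
  have "mat c *v (A *v v) = A *v (mat c *v v)" for v
    by (simp add: mat_vector_mult vec_eq_iff matrix_vector_mult_2 algebra_simps)
  then show ?thesis by (simp add: matrix_eq flip: matrix_vector_mul_assoc)
qed

lemma weighted_action_diagonal: "weighted_action d d t v = t ^ d *s v"
  by (simp add: weighted_action_def vec_eq_iff forall_2)

lemma linear_map_regular:
  assumes "\<And>v. v \<in> Y \<Longrightarrow> f v = A *v v"
  shows "regular_map_on Y f"
  unfolding regular_map_on_def regular_function_on_def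
proof (intro allI ballI)
  fix i :: 2 and v :: "complex^2"
  define g where "g = [:[:0, A $ i $ 1:], [:A $ i $ 2:]:]"
  have "zariski_open UNIV"
    unfolding zariski_open_def by (intro exI[of _ "{1}"]) (simp add: eval2_def)
  moreover have "eval2 1 w \<noteq> 0 \<and> f w $ i = eval2 g w / eval2 1 w" if "w \<in> UNIV \<inter> Y" for w
    using assms that by (simp add: g_def eval2_def matrix_vector_mult_2)
  ultimately show "\<exists>U g h. zariski_open U \<and> v \<in> U \<and>
      (\<forall>w\<in>U \<inter> Y. eval2 h w \<noteq> 0 \<and> f w $ i = eval2 g w / eval2 h w)"
    by blast
qed

lemma regular_map_homogeneous_linear:
  assumes f: "regular_map_on punctured_plane f"
    and hom: "\<And>s v. s \<noteq> 0 \<Longrightarrow> v \<in> punctured_plane \<Longrightarrow> f (s *s v) = s *s f v"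
  shows "\<exists>A. \<forall>v\<in>punctured_plane. f v = A *v v"
proof -
  have "\<exists>a b. \<forall>v\<in>punctured_plane. f v $ i = a * v $ 1 + b * v $ 2" for i
    using f hom by (intro regular_homogeneous_linear) (auto simp: regular_map_on_def)
  then obtain a b where "\<And>i v. v \<in> punctured_plane \<Longrightarrow> f v $ i = a i * v $ 1 + b i * v $ 2"
    by metis
  then have "\<forall>v\<in>punctured_plane. f v = (\<chi> i. vector [a i, b i]) *v v"
    by (simp add: vec_eq_iff matrix_vector_mult_2)
  then show ?thesis by blast
qed

lemma linear_automorphism_apply:
  "v \<in> punctured_plane \<Longrightarrow> linear_automorphism A v = A *v v"
  by (simp add: linear_automorphism_def)

lemma invertible_punctured_plane:
  "invertible A \<Longrightarrow> v \<in> punctured_plane \<Longrightarrow> A *v v \<in> punctured_plane"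
  by (auto simp: punctured_plane_def invertible_iff_ker)

lemma linear_automorphism_inverse:
  assumes AB: "A ** B = mat 1"
  shows "linear_automorphism A \<in> Bij punctured_plane"
    and "\<And>v. v \<in> punctured_plane \<Longrightarrow> inv_into punctured_plane (linear_automorphism A) v = B *v v"
proof -
  have BA: "B ** A = mat 1" using AB by (simp add: matrix_left_right_inverse)
  then have inv: "invertible A" "invertible B"
    using AB by (auto simp: invertible_def)
  have bij: "bij_betw (linear_automorphism A) punctured_plane punctured_plane"
    by (rule bij_betw_byWitness[where f' = "(*v) B"])
      (auto simp: linear_automorphism_apply invertible_punctured_plane inv
        matrix_vector_mul_assoc AB BA)
  then show "linear_automorphism A \<in> Bij punctured_plane"
    by (simp add: Bij_def linear_automorphism_def)
  show "inv_into punctured_plane (linear_automorphism A) v = B *v v" if "v \<in> punctured_plane" for v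
    using that bij
    by (intro inv_into_f_eq)
      (auto simp: bij_betw_def linear_automorphism_apply invertible_punctured_plane inv
        matrix_vector_mul_assoc AB)
qed

lemma linear_automorphism_algebraic:
  assumes "invertible A"
  shows "algebraic_automorphism punctured_plane (linear_automorphism A)"
proof -
  obtain B where AB: "A ** B = mat 1"
    using assms by (auto simp: invertible_def)
  show ?thesis
    unfolding algebraic_automorphism_def
    using linear_automorphism_inverse[OF AB]
    by (auto intro!: linear_map_regular linear_automorphism_apply)
qed

text \<open>
  Equivariance only speaks of scalars of the form \<open>t ^ d\<close>; since \<open>\<complex>\<close> is algebraically closed and
  \<open>d\<close> is positive, these are all the nonzero ones. The matrix of an automorphism is invertible
  because the automorphism sends no nonzero vector to \<open>0\<close>.
\<close>

lemma carrier_G_weighted_diagonal: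
  assumes "d \<ge> 1"
  shows "carrier (G_weighted d d) = linear_automorphism ` carrier GL2"
proof
  show "linear_automorphism ` carrier GL2 \<subseteq> carrier (G_weighted d d)"
  proof
    fix f assume "f \<in> linear_automorphism ` carrier GL2"
    then obtain A where A: "invertible A" and f: "f = linear_automorphism A"
      by (auto simp: GL2_def)
    have "s *s v \<in> punctured_plane" if "s \<noteq> 0" "v \<in> punctured_plane" for s v
      using that by (auto simp: punctured_plane_def)
    then have "f (weighted_action d d t v) = weighted_action d d t (f v)"
      if "t \<noteq> 0" "v \<in> punctured_plane" for t v
      using that by (simp add: f weighted_action_diagonal linear_automorphism_apply
          matrix_vector_mul_assoc mat_mult_commute flip: mat_vector_mult)
    then show "f \<in> carrier (G_weighted d d)"
      using linear_automorphism_algebraic[OF A] by (auto simp: G_weighted_def Cstar_def f)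
  qed
  show "carrier (G_weighted d d) \<subseteq> linear_automorphism ` carrier GL2"
  proof
    fix f assume "f \<in> carrier (G_weighted d d)"
    then have Bij: "f \<in> Bij punctured_plane" and reg: "regular_map_on punctured_plane f"
      and eq: "\<And>t v. t \<noteq> 0 \<Longrightarrow> v \<in> punctured_plane \<Longrightarrow> f (t ^ d *s v) = t ^ d *s f v"
      by (auto simp: G_weighted_def algebraic_automorphism_def Cstar_def weighted_action_diagonal)
    have "f (s *s v) = s *s f v" if s: "s \<noteq> 0" and v: "v \<in> punctured_plane" for s v
    proof -
      obtain t where t: "s = t ^ d"
        using exists_complex_root[of d s] assms by auto
      with s assms have "t \<noteq> 0" by (auto simp: power_0_left)
      with eq v t show ?thesis by blast
    qed
    with reg obtain A where A: "\<And>v. v \<in> punctured_plane \<Longrightarrow> f v = A *v v"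
      using regular_map_homogeneous_linear by metis
    have "f v \<in> punctured_plane" if "v \<in> punctured_plane" for v
      using that Bij_imp_funcset[OF Bij] by auto
    then have "invertible A"
      using A by (force simp: invertible_iff_ker punctured_plane_def)
    moreover have "f = linear_automorphism A"
      using A Bij by (auto simp: linear_automorphism_def Bij_def intro!: extensionalityI)
    ultimately show "f \<in> linear_automorphism ` carrier GL2"
      by (auto simp: GL2_def)
  qed
qed

lemma linear_automorphism_inj: "inj linear_automorphism"
proof
  fix A B assume eq: "linear_automorphism A = linear_automorphism B"
  have "A *v v = B *v v" for v
  proof (cases "v = 0")
    case False
    then show ?thesis
      using fun_cong[OF eq, of v] by (simp add: linear_automorphism_def punctured_plane_def)
  qed simp
  then show "A = B" by (simp add: matrix_eq)
qed

lemma linear_automorphism_hom: "linear_automorphism \<in> hom GL2 (BijGroup punctured_plane)"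
proof (rule homI)
  have Bij: "linear_automorphism A \<in> Bij punctured_plane" if "invertible A" for A
    using linear_automorphism_algebraic[OF that] by (simp add: algebraic_automorphism_def)
  then show "linear_automorphism A \<in> carrier (BijGroup punctured_plane)" if "A \<in> carrier GL2" for A
    using that by (simp add: GL2_def BijGroup_def)
  fix A B assume "A \<in> carrier GL2" "B \<in> carrier GL2"
  then have "invertible A" "invertible B" by (simp_all add: GL2_def)
  then show "linear_automorphism (A \<otimes>\<^bsub>GL2\<^esub> B) =
      linear_automorphism A \<otimes>\<^bsub>BijGroup punctured_plane\<^esub> linear_automorphism B"
    using Bij[of A] Bij[of B]
    by (auto simp: GL2_def BijGroup_def linear_automorphism_def compose_def
        invertible_punctured_plane matrix_vector_mul_assoc)
qed

text \<open>
  The group axioms for \<open>G_weighted d d\<close> come for free: it is the image of \<open>GL2\<close> in the group of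
  all bijections of the punctured plane.
\<close>

lemma G_weighted_diagonal:
  assumes "d \<ge> 1"
  shows "group (G_weighted d d)"
    and "linear_automorphism \<in> iso GL2 (G_weighted d d)"
proof -
  interpret h: group_hom GL2 "BijGroup punctured_plane" linear_automorphism
    by (simp add: group_hom_def group_hom_axioms_def GL2_group group_BijGroup
        linear_automorphism_hom)
  have G: "G_weighted d d = BijGroup punctured_plane \<lparr>carrier := linear_automorphism ` carrier GL2\<rparr>"
    using carrier_G_weighted_diagonal[OF assms] by (simp add: G_weighted_def)
  show "group (G_weighted d d)"
    unfolding G by (rule subgroup.subgroup_is_group[OF h.img_is_subgroup group_BijGroup])
  show "linear_automorphism \<in> iso GL2 (G_weighted d d)"
    using linear_automorphism_hom linear_automorphism_inj
    by (auto simp: G iso_def hom_def bij_betw_def intro: inj_on_subset)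
qed

section \<open>The two crossed modules\<close>

lemma Cstar_comm_group: "comm_group Cstar"
proof (rule comm_groupI)
  fix x assume "x \<in> carrier Cstar"
  then show "\<exists>y\<in>carrier Cstar. y \<otimes>\<^bsub>Cstar\<^esub> x = \<one>\<^bsub>Cstar\<^esub>"
    by (intro bexI[of _ "inverse x"]) (auto simp: Cstar_def)
qed (auto simp: Cstar_def)

lemma mat_hom: "(\<lambda>t. mat (t ^ d)) \<in> hom Cstar GL2"
proof (rule homI)
  fix s t
  show "mat (t ^ d) \<in> carrier GL2" if "t \<in> carrier Cstar"
    using that by (auto simp: Cstar_def GL2_def invertible_iff_ker mat_vector_mult)
  show "mat ((s \<otimes>\<^bsub>Cstar\<^esub> t) ^ d) = mat (s ^ d) \<otimes>\<^bsub>GL2\<^esub> mat (t ^ d)"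
    by (simp add: Cstar_def GL2_def matrix_eq mat_vector_mult power_mult_distrib
        flip: matrix_vector_mul_assoc)
qed

lemma weighted_action_eq_linear_automorphism:
  "restrict (weighted_action d d t) punctured_plane = linear_automorphism (mat (t ^ d))"
  by (auto simp: linear_automorphism_def weighted_action_diagonal mat_vector_mult)

lemma GL2_crossed_module: "crossed_module (GL2_crossed_module d)"
  by (rule crossed_module_central)
    (simp_all add: GL2_crossed_module_def Cstar_comm_group GL2_group mat_hom,
      simp add: GL2_def mat_mult_commute)

lemma PGL_weighted_crossed_module:
  assumes "d \<ge> 1"
  shows "crossed_module (PGL_weighted d d)"
proof (rule crossed_module_central)
  note L = G_weighted_diagonal(2)[OF assms]
  then have Lh: "linear_automorphism \<in> hom GL2 (G_weighted d d)"
    and Lim: "carrier (G_weighted d d) = linear_automorphism ` carrier GL2"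
    by (auto simp: iso_def bij_betw_def)
  show "bd (PGL_weighted d d) \<in> hom (src (PGL_weighted d d)) (tgt (PGL_weighted d d))"
    using hom_compose[OF mat_hom[of d] Lh]
    by (simp add: PGL_weighted_def weighted_action_eq_linear_automorphism comp_def)
  fix t f
  assume "t \<in> carrier (src (PGL_weighted d d))" "f \<in> carrier (tgt (PGL_weighted d d))"
  then obtain A where A: "A \<in> carrier GL2" "f = linear_automorphism A"
    and t: "mat (t ^ d) \<in> carrier GL2"
    using mat_hom[of d] by (auto simp: PGL_weighted_def Lim hom_def)
  have "mat (t ^ d) \<otimes>\<^bsub>GL2\<^esub> A = A \<otimes>\<^bsub>GL2\<^esub> mat (t ^ d)"
    by (simp add: GL2_def mat_mult_commute)
  then show "bd (PGL_weighted d d) t \<otimes>\<^bsub>tgt (PGL_weighted d d)\<^esub> f =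
      f \<otimes>\<^bsub>tgt (PGL_weighted d d)\<^esub> bd (PGL_weighted d d) t"
    using A t hom_mult[OF Lh, of A "mat (t ^ d)"] hom_mult[OF Lh, of "mat (t ^ d)" A]
    by (simp add: PGL_weighted_def weighted_action_eq_linear_automorphism)
qed (simp_all add: PGL_weighted_def Cstar_comm_group G_weighted_diagonal[OF assms])

lemma PGL_weighted_isomorphic_GL2:
  assumes "d \<ge> 1"
  shows "crossed_module_isomorphic (PGL_weighted d d) (GL2_crossed_module d)"
proof -
  define f1 where "f1 = inv_into (carrier GL2) linear_automorphism"
  have "f1 \<in> iso (G_weighted d d) GL2"
    unfolding f1_def by (rule group.iso_set_sym[OF GL2_group G_weighted_diagonal(2)[OF assms]])
  moreover have "f1 (linear_automorphism A) = A" if "A \<in> carrier GL2" for A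
    unfolding f1_def using that linear_automorphism_inj
    by (intro inv_into_f_f) (auto intro: inj_on_subset)
  then have "f1 (linear_automorphism (mat (t ^ d))) = mat (t ^ d)" if "t \<in> carrier Cstar" for t
    using that mat_hom[of d] by (auto simp: hom_def)
  moreover have "id \<in> iso Cstar Cstar"
    by (rule iso_set_refl[unfolded id_def[symmetric]])
  ultimately show ?thesis
    unfolding crossed_module_isomorphic_def
    by (intro bexI[of _ id] bexI[of _ f1])
      (auto simp: PGL_weighted_def GL2_crossed_module_def weighted_action_eq_linear_automorphism)
qed

lemma pi1_GL2_crossed_module:
  assumes "d \<ge> 1"
  shows "pi1 (GL2_crossed_module d) = PGL2"
proof -
  have "(\<lambda>t. mat (t ^ d)) ` (- {0}) = {mat c :: complex^2^2 |c. c \<noteq> 0}"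
  proof (intro equalityI subsetI)
    fix M :: "complex^2^2" assume "M \<in> {mat c |c. c \<noteq> 0}"
    then obtain c where c: "c \<noteq> 0" "M = mat c" by blast
    obtain t where t: "c = t ^ d"
      using exists_complex_root[of d c] assms by auto
    with c assms have "t \<noteq> 0" by (auto simp: power_0_left)
    with c t show "M \<in> (\<lambda>t. mat (t ^ d)) ` (- {0})" by blast
  qed auto
  then show ?thesis
    by (simp add: pi1_def PGL2_def GL2_crossed_module_def Cstar_def)
qed

text \<open>
  The isomorphism sends \<open>k\<close> to the root of unity \<open>exp (2 \<pi> i k / d)\<close>.
\<close>

lemma pi2_GL2_crossed_module:
  assumes "d \<ge> 1"
  shows "pi2 (GL2_crossed_module d) \<cong> integer_mod_group d"
proof -
  have mat_eq: "mat c = (mat 1 :: complex^2^2) \<longleftrightarrow> c = 1" for c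
    by (auto simp: mat_def vec_eq_iff forall_2)
  have ker: "carrier (pi2 (GL2_crossed_module d)) = {z. z ^ d = 1}"
    using assms
    by (auto simp: pi2_def kernel_def GL2_crossed_module_def Cstar_def GL2_def mat_eq power_0_left)
  define \<zeta> where "\<zeta> k = cis (2 * pi * real_of_int k / real d)" for k
  have "bij_betw (\<lambda>k. cis (2 * pi * real k / real d)) {..<d} {z. z ^ d = 1}"
    using assms by (intro Complex.bij_betw_roots_unity) simp
  moreover have "bij_betw nat {0..<int d} {..<d}"
    by (rule bij_betw_byWitness[where f' = int]) auto
  ultimately have "bij_betw ((\<lambda>k. cis (2 * pi * real k / real d)) \<circ> nat) {0..<int d} {z. z ^ d = 1}"
    by (rule bij_betw_trans[rotated])
  then have bij: "bij_betw \<zeta> {0..<int d} {z. z ^ d = 1}"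
    by (rule bij_betw_cong[THEN iffD1, rotated]) (simp add: \<zeta>_def)
  have "\<zeta> ((j + k) mod int d) = \<zeta> j * \<zeta> k" for j k
  proof -
    \<comment> \<open>Reducing the exponent modulo \<open>d\<close> changes the angle by the \<open>q\<close>-fold full turn.\<close>
    define q where "q = (j + k) div int d"
    have "j + k = (j + k) mod int d + int d * q"
      by (simp add: q_def)
    then have *: "real_of_int j + real_of_int k =
        real_of_int ((j + k) mod int d) + real d * real_of_int q"
      by (metis of_int_add of_int_mult of_int_of_nat_eq)
    have "2 * pi * real_of_int j / real d + 2 * pi * real_of_int k / real d =
        2 * pi / real d * (real_of_int j + real_of_int k)"
      by (simp add: add_divide_distrib distrib_left)
    also have "\<dots> = 2 * pi * real_of_int ((j + k) mod int d) / real d + 2 * pi * real_of_int q"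
      unfolding * using assms by (simp add: distrib_left)
    finally have "\<zeta> j * \<zeta> k = \<zeta> ((j + k) mod int d) * cis (2 * pi * real_of_int q)"
      by (simp only: \<zeta>_def cis_mult)
    then show ?thesis by simp
  qed
  then have "\<zeta> \<in> iso (integer_mod_group d) (pi2 (GL2_crossed_module d))"
    using assms bij ker
    by (auto simp: iso_def hom_def carrier_integer_mod_group bij_betw_def)
      (auto simp: pi2_def GL2_crossed_module_def Cstar_def)
  then have "integer_mod_group d \<cong> pi2 (GL2_crossed_module d)"
    unfolding is_iso_def by blast
  then show ?thesis
    by (rule group.iso_sym[OF group_integer_mod_group])
qed

theorem proposition8p6:
  fixes d :: nat
  assumes "d \<ge> 1"
  shows "crossed_module (PGL_weighted d d) \<and>
         crossed_module (GL2_crossed_module d) \<and>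
         crossed_module_isomorphic (PGL_weighted d d) (GL2_crossed_module d) \<and>
         pi1 (PGL_weighted d d) \<cong> PGL2 \<and>
         pi2 (PGL_weighted d d) \<cong> integer_mod_group d"
proof -
  note X = PGL_weighted_crossed_module[OF assms]
    and Y = GL2_crossed_module[of d]
    and XY = PGL_weighted_isomorphic_GL2[OF assms]
  have "pi1 (PGL_weighted d d) \<cong> PGL2"
    using pi1_cong[OF X Y XY] by (simp add: pi1_GL2_crossed_module[OF assms])
  moreover have "pi2 (PGL_weighted d d) \<cong> integer_mod_group d"
    using pi2_cong[OF X Y XY] pi2_GL2_crossed_module[OF assms] by (rule iso_trans)
  ultimately show ?thesis
    using X Y XY by blast
qed

end
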